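(* Let $n \ge k \ge 1$ be integers and let $\underline{x} = (x_1,\dots,x_n)$ with $x_i \ge 0$ for all $i$. Then $$\mathsf{hsm}_{k/n}(\underline{x}) \;\le\; \mathsf{sym}_k(\underline{x}) \;\le\; \frac{\binom{n}{k}^{-1/k}}{B\left(\frac{k}{n}\right)}\, \mathsf{hsm}_{k/n}(\underline{x}) .$$
   Context: Conventions: $\log 0 = -\infty$, $\exp(-\infty)=0$, $\exp(+\infty)=+\infty$. Halász–Székely (HS) kernel: for $x\in[0,\infty)$, $y\in(0,\infty)$, $c\in[0,1]$, $$K(x,y,c) = \begin{cases}\log y + c^{-1}\log(c y^{-1}x + 1 - c) & c>0,\\ \log y + y^{-1}x - 1 & c=0.\end{cases}$$ For a Borel probability measure $\mu$ on $[0,\infty)$ and $c\in[0,1]$ (if $c=1$, assume that $\log x$ is semi-integrable with respect to $\mu$, i.e. its positive part or its negative part is $\mu$-integrable), the HS barycenter is $$[\mu]_c = \exp \inf_{y>0}\int K(x,y,c)\,d\mu(x) \in [0,+\infty].$$ For a tuple $\underline{x}=(x_1,\dots,x_n)$ of nonnegative numbers, the HS mean is $\mathsf{hsm}_c(\underline{x}) = \left[\frac{\delta_{x_1}+\dots+\delta_{x_n}}{n}\right]_c$, where $\delta_x$ is the unit mass at $x$. The $k$-th symmetric mean is $\mathsf{sym}_k(\underline{x}) = \left( E_k^{(n)}(\underline{x}) / \binom{n}{k}\right)^{1/k}$, where $E_k^{(n)}(\underline{x})=\sum_{i_1<\dots<i_k} x_{i_1}\cdots x_{i_k}$ is the elementary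 symmetric polynomial of degree $k$. The function $B\colon[0,1]\to[0,1]$ is $B(0)=0$, $B(c)=c(1-c)^{\frac{1-c}{c}}$ for $0<c<1$, $B(1)=1$. *)

theory Defs
  imports "HOL-Probability.Probability"
begin

text \<open>Logarithm on \<open>[0,\<infinity>)\<close> and exponential on \<open>[-\<infinity>,\<infinity>]\<close>, with the conventions
  \<open>log 0 = -\<infinity>\<close>, \<open>exp (-\<infinity>) = 0\<close> and \<open>exp (+\<infinity>) = +\<infinity>\<close>.\<close>

definition ext_ln :: "real \<Rightarrow> ereal" where
  "ext_ln t = (if t > 0 then ereal (ln t) else -\<infinity>)"

fun ext_exp :: "ereal \<Rightarrow> ennreal" where
  "ext_exp (ereal t) = ennreal (exp t)"
| "ext_exp PInfty = \<infinity>"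
| "ext_exp MInfty = 0"

text \<open>The Halasz--Szekely kernel, for \<open>x \<ge> 0\<close>, \<open>y > 0\<close>, \<open>0 \<le> c \<le> 1\<close>. The value \<open>-\<infinity>\<close>
  occurs only for \<open>c = 1\<close>, \<open>x = 0\<close>.\<close>

definition HS_kernel :: "real \<Rightarrow> real \<Rightarrow> real \<Rightarrow> ereal" where
  "HS_kernel x y c =
     (if c > 0 then ereal (ln y) + ereal (inverse c) * ext_ln (c * inverse y * x + 1 - c)
      else ereal (ln y + inverse y * x - 1))"

text \<open>The integral of an extended-real function, as positive part minus negative part; it is
  meaningful when at least one of the two is finite.\<close>

definition ext_integral :: "'a measure \<Rightarrow> ('a \<Rightarrow> ereal) \<Rightarrow> ereal" where
  "ext_integral M f =
     enn2ereal (\<integral>\<^sup>+ x. e2ennreal (f x) \<partial>M) - enn2ereal (\<integral>\<^sup>+ x. e2ennreal (- f x) \<partial>M)"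

definition semi_integrable :: "'a measure \<Rightarrow> ('a \<Rightarrow> ereal) \<Rightarrow> bool" where
  "semi_integrable M f \<longleftrightarrow> f \<in> borel_measurable M \<and>
     ((\<integral>\<^sup>+ x. e2ennreal (f x) \<partial>M) < \<infinity> \<or> (\<integral>\<^sup>+ x. e2ennreal (- f x) \<partial>M) < \<infinity>)"

abbreviation nonneg_borel :: "real measure" where
  "nonneg_borel \<equiv> restrict_space borel {0..}"

text \<open>The HS barycenter of a Borel probability measure \<open>M\<close> on \<open>[0,\<infinity>)\<close>, i.e. a probability
  measure with the \<sigma>-algebra of \<^term>\<open>nonneg_borel\<close>. For \<open>c = 1\<close> it is meant only for \<open>M\<close> such that
  \<^term>\<open>semi_integrable M ext_ln\<close>; the empirical measures below always satisfy this
  (lemma \<open>semi_integrable_empirical\<close>).\<close>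

definition HS_barycenter :: "real measure \<Rightarrow> real \<Rightarrow> ennreal" where
  "HS_barycenter M c = ext_exp (INF y\<in>{0<..}. ext_integral M (\<lambda>x. HS_kernel x y c))"

text \<open>Tuples \<open>(x\<^sub>1,\<dots>,x\<^sub>n)\<close> are functions on \<open>{1..n}\<close>; the other values are irrelevant.\<close>

definition empirical :: "nat \<Rightarrow> (nat \<Rightarrow> real) \<Rightarrow> real measure" where
  "empirical n x = measure_of (space nonneg_borel) (sets nonneg_borel)
     (\<lambda>A. (\<Sum>i\<in>{1..n}. emeasure (return nonneg_borel (x i)) A) / of_nat n)"

definition hsm :: "real \<Rightarrow> nat \<Rightarrow> (nat \<Rightarrow> real) \<Rightarrow> ennreal" where
  "hsm c n x = HS_barycenter (empirical n x) c"

text \<open>A choice of indices \<open>i\<^sub>1 < \<dots> < i\<^sub>k\<close> is encoded as the set of these indices.\<close>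

definition elem_sym :: "nat \<Rightarrow> nat \<Rightarrow> (nat \<Rightarrow> real) \<Rightarrow> real" where
  "elem_sym k n x = (\<Sum>S | S \<subseteq> {1..n} \<and> card S = k. \<Prod>i\<in>S. x i)"

definition sym_mean :: "nat \<Rightarrow> nat \<Rightarrow> (nat \<Rightarrow> real) \<Rightarrow> real" where
  "sym_mean k n x = (elem_sym k n x / real (n choose k)) powr (1 / real k)"

definition HS_B :: "real \<Rightarrow> real" where
  "HS_B c = (if c = 0 then 0 else if c = 1 then 1 else c * (1 - c) powr ((1 - c) / c))"


lemma sets_empirical [simp, measurable_cong]: "sets (empirical n x) = sets nonneg_borel"
  unfolding empirical_def by (metis sets.sets_measure_of_eq)

lemma space_empirical [simp]: "space (empirical n x) = {0..}"
  using sets_eq_imp_space_eq[OF sets_empirical] by (simp add: space_restrict_space)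

lemma emeasure_empirical:
  assumes "A \<in> sets nonneg_borel"
  shows "emeasure (empirical n x) A =
    (\<Sum>i\<in>{1..n}. emeasure (return nonneg_borel (x i)) A) / of_nat n"
proof (rule emeasure_measure_of[OF empirical_def])
  show "sets nonneg_borel \<subseteq> Pow (space nonneg_borel)"
    by (rule sets.space_closed)
  show "A \<in> sets (empirical n x)" using assms by simp
  let ?m = "\<lambda>A. (\<Sum>i\<in>{1..n}. emeasure (return nonneg_borel (x i)) A) / of_nat n"
  show "positive (sets (empirical n x)) ?m"
    by (simp add: positive_def)
  show "countably_additive (sets (empirical n x)) ?m"
  proof (rule countably_additiveI)
    fix F :: "nat \<Rightarrow> real set"
    assume F: "range F \<subseteq> sets (empirical n x)" "disjoint_family F" "(\<Union>i. F i) \<in> sets (empirical n x)"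
    have "(\<Sum>j. ?m (F j)) = (\<Sum>j. \<Sum>i\<in>{1..n}. emeasure (return nonneg_borel (x i)) (F j)) / of_nat n"
      by (simp add: divide_ennreal_def)
    also have "(\<Sum>j. \<Sum>i\<in>{1..n}. emeasure (return nonneg_borel (x i)) (F j)) =
        (\<Sum>i\<in>{1..n}. \<Sum>j. emeasure (return nonneg_borel (x i)) (F j))"
      by (rule suminf_sum) simp
    also have "\<dots> = (\<Sum>i\<in>{1..n}. emeasure (return nonneg_borel (x i)) (\<Union>j. F j))"
      using F by (intro sum.cong refl suminf_emeasure) auto
    finally show "(\<Sum>j. ?m (F j)) = ?m (\<Union>j. F j)" .
  qed
qed

lemma prob_space_empirical:
  assumes "n \<ge> 1" "\<And>i. i \<in> {1..n} \<Longrightarrow> x i \<ge> 0"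
  shows "prob_space (empirical n x)"
proof
  have 1: "({0..}::real set) \<in> sets nonneg_borel"
    by (auto simp: sets_restrict_space)
  have "(\<Sum>i\<in>{1..n}. emeasure (return nonneg_borel (x i)) {0..}) = (\<Sum>i\<in>{1..n}. 1)"
    using assms 1 by (intro sum.cong) (auto simp: emeasure_return)
  then show "emeasure (empirical n x) (space (empirical n x)) = 1"
    using assms(1) 1 ennreal_divide_self[of "of_nat n"]
    by (simp add: emeasure_empirical less_top[symmetric] of_nat_less_top)
qed

lemma ext_ln_measurable: "ext_ln \<in> borel_measurable borel"
  unfolding ext_ln_def by measurable

lemma semi_integrable_empirical:
  assumes "n \<ge> 1" "\<And>i. i \<in> {1..n} \<Longrightarrow> x i \<ge> 0"
  shows "semi_integrable (empirical n x) ext_ln"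
proof -
  interpret prob_space "empirical n x" using assms by (rule prob_space_empirical)
  have m: "ext_ln \<in> borel_measurable (empirical n x)"
    using measurable_restrict_space1[OF ext_ln_measurable] measurable_cong_sets[OF sets_empirical refl]
    by blast
  define b where "b = (\<Sum>i\<in>{1..n}. x i)"
  have xb: "x i \<le> b" if "i \<in> {1..n}" for i
    unfolding b_def using assms that by (intro member_le_sum) auto
  have N: "{0..} - {0..b} \<in> sets nonneg_borel"
    by (auto simp: sets_restrict_space)
  have "emeasure (empirical n x) ({0..} - {0..b}) = 0"
    using N xb assms by (simp add: emeasure_empirical emeasure_return)
  then have "AE t in empirical n x. t \<le> b"
    using N by (intro AE_I[where N="{0..} - {0..b}"]) auto
  moreover have "e2ennreal (ext_ln t) \<le> ennreal b" if "t \<le> b" for t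
  proof (cases "t > 0")
    case True
    have "e2ennreal (ext_ln t) = ennreal (ln t)"
      using True by (simp add: ext_ln_def)
    also have "\<dots> \<le> ennreal b"
      using True that ln_le_minus_one[of t] by (intro ennreal_leI) linarith
    finally show ?thesis .
  next
    case False
    then show ?thesis by (simp add: ext_ln_def e2ennreal_neg)
  qed
  ultimately have "(\<integral>\<^sup>+ t. e2ennreal (ext_ln t) \<partial>empirical n x) \<le> (\<integral>\<^sup>+ t. ennreal b \<partial>empirical n x)"
    by (intro nn_integral_mono_AE) auto
  also have "\<dots> < \<infinity>"
    using emeasure_space_1 by simp
  finally show ?thesis unfolding semi_integrable_def using m by simp
qed

end

theory Submission
  imports Defs
begin

text \<open>With \<open>c = k/n\<close>, the \<open>k\<close>-th power of the HS mean is the infimum over \<open>y > 0\<close> of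
  \<open>\<Phi>(y) = y\<^sup>k \<Prod>\<^sub>i (c x\<^sub>i / y + 1 - c) = \<Sum>\<^sub>j E\<^sub>j c\<^sup>j (1 - c)\<^bsup>n-j\<^esup> y\<^bsup>k-j\<^esup>\<close>.
  Every value is at least the term \<open>j = k\<close>, which is \<open>E\<^sub>k B(c)\<^sup>k\<close>; this is the upper bound on the
  symmetric mean. For the lower bound write \<open>E\<^sub>j = (n choose j) s\<^sub>j\<close>. If all \<open>x\<^sub>i\<close> are positive, Newton's
  inequalities say that \<open>s\<close> is log-concave, so \<open>s\<^sub>j \<le> s\<^sub>k r\<^bsup>j-k\<^esup>\<close> with \<open>r = s\<^sub>k / s\<^bsub>k-1\<^esub>\<close>, and the
  binomial theorem gives \<open>\<Phi>(r) \<le> s\<^sub>k\<close>. The general case follows by replacing \<open>x\<^sub>i\<close> with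
  \<open>x\<^sub>i + e\<close> and letting \<open>e\<close> tend to \<open>0\<close>, because \<open>\<Phi>\<close> is increasing in \<open>x\<close>.\<close>

section \<open>Elementary symmetric functions over a finite index set\<close>

text \<open>The index set is arbitrary rather than \<open>{1..n}\<close>, so that variables can be
  added one at a time by induction.\<close>

definition esym :: "'a set \<Rightarrow> nat \<Rightarrow> ('a \<Rightarrow> real) \<Rightarrow> real" where
  "esym A k x = (\<Sum>S | S \<subseteq> A \<and> card S = k. \<Prod>i\<in>S. x i)"

text \<open>These are the numbers \<open>s_k\<close> of the outline. For \<open>k > card A\<close>
  the denominator is 0, so the value is 0, and identities and inequalities in \<open>k\<close> need
  no range restriction at the top end.\<close>

definition nsym :: "'a set \<Rightarrow> nat \<Rightarrow> ('a \<Rightarrow> real) \<Rightarrow> real" where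
  "nsym A k x = esym A k x / real (card A choose k)"

lemma esym_0: "finite A \<Longrightarrow> esym A 0 x = 1"
proof -
  assume "finite A"
  then have "{S. S \<subseteq> A \<and> card S = 0} = {{}}"
    by (auto dest: finite_subset)
  then show ?thesis by (simp add: esym_def)
qed

lemma esym_eq_0:
  assumes "finite A" "card A < k"
  shows "esym A k x = 0"
proof -
  have "{S. S \<subseteq> A \<and> card S = k} = {}"
    using assms by (auto dest: card_mono)
  then show ?thesis by (simp only: esym_def sum.empty)
qed

lemma esym_nonneg:
  assumes "\<And>i. i \<in> A \<Longrightarrow> 0 \<le> x i"
  shows "0 \<le> esym A k x"
  unfolding esym_def using assms by (intro sum_nonneg prod_nonneg) auto

lemma esym_pos:
  assumes "finite A" "k \<le> card A" "\<And>i. i \<in> A \<Longrightarrow> 0 < x i"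
  shows "0 < esym A k x"
proof -
  obtain S where S: "S \<subseteq> A" "card S = k"
    using assms(1,2) by (meson obtain_subset_with_card_n)
  show ?thesis
    unfolding esym_def
  proof (rule sum_pos)
    show "finite {S. S \<subseteq> A \<and> card S = k}" using assms(1) by simp
    show "{S. S \<subseteq> A \<and> card S = k} \<noteq> {}" using S by blast
  qed (use assms(3) in \<open>auto intro!: prod_pos\<close>)
qed

text \<open>The index sets of size \<open>Suc k\<close> split into those that avoid \<open>a\<close>
  and those of the form \<open>insert a S\<close> with \<open>S\<close> a subset of \<open>A\<close>
  of size \<open>k\<close>.\<close>

lemma esym_insert:
  assumes "finite A" "a \<notin> A"
  shows "esym (insert a A) (Suc k) x = esym A (Suc k) x + x a * esym A k x"
proof -
  let ?P = "{S. S \<subseteq> A \<and> card S = Suc k}" and ?Q = "{S. S \<subseteq> A \<and> card S = k}"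
  have fin: "finite S" if "S \<subseteq> A" for S using that assms(1) finite_subset by blast
  have inj: "inj_on (insert a) ?Q"
    using assms(2) by (auto simp: inj_on_def dest: insert_ident)
  have "{S. S \<subseteq> insert a A \<and> card S = Suc k} = ?P \<union> insert a ` ?Q"
  proof (intro equalityI subsetI)
    fix S assume S: "S \<in> {S. S \<subseteq> insert a A \<and> card S = Suc k}"
    show "S \<in> ?P \<union> insert a ` ?Q"
    proof (cases "a \<in> S")
      case True
      then have "S = insert a (S - {a})" "S - {a} \<in> ?Q"
        using S by (auto simp: card_Diff_singleton_if)
      then show ?thesis by blast
    next
      case False
      then show ?thesis using S by auto
    qed
  next
    fix S assume "S \<in> ?P \<union> insert a ` ?Q"
    then show "S \<in> {S. S \<subseteq> insert a A \<and> card S = Suc k}"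
      using assms(2) fin by (auto simp: card_insert_if)
  qed
  moreover have "?P \<inter> insert a ` ?Q = {}" using assms(2) by blast
  ultimately have "esym (insert a A) (Suc k) x
      = esym A (Suc k) x + (\<Sum>S\<in>insert a ` ?Q. \<Prod>i\<in>S. x i)"
    unfolding esym_def using assms(1) by (simp add: sum.union_disjoint)
  also have "(\<Sum>S\<in>insert a ` ?Q. \<Prod>i\<in>S. x i) = (\<Sum>S\<in>?Q. x a * (\<Prod>i\<in>S. x i))"
    unfolding sum.reindex[OF inj] o_def
    using assms(2) fin by (intro sum.cong refl prod.insert) auto
  finally show ?thesis by (simp add: esym_def sum_distrib_left)
qed

text \<open>Multiplying out gives one term for each subset of \<open>A\<close>; grouping the subsets
  by cardinality collects the symmetric functions.\<close>

lemma prod_affine_eq_sum_esym: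
  assumes "finite A"
  shows "(\<Prod>i\<in>A. u * x i + v) = (\<Sum>j\<le>card A. esym A j x * u ^ j * v ^ (card A - j))"
proof -
  have fin: "finite S" if "S \<subseteq> A" for S using that assms finite_subset by blast
  have "(\<Prod>i\<in>A. u * x i + v) = (\<Sum>S\<in>Pow A. (\<Prod>i\<in>S. u * x i) * (\<Prod>i\<in>A - S. v))"
    using assms by (rule prod_add)
  also have "\<dots> = (\<Sum>S\<in>Pow A. (\<Prod>i\<in>S. x i) * u ^ card S * v ^ (card A - card S))"
    using fin by (intro sum.cong refl) (auto simp: prod.distrib card_Diff_subset)
  also have "\<dots> = (\<Sum>j\<le>card A. \<Sum>S | S \<in> Pow A \<and> card S = j.
      (\<Prod>i\<in>S. x i) * u ^ card S * v ^ (card A - card S))"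
    using assms by (intro sum.group[symmetric]) (auto intro: card_mono)
  also have "\<dots> = (\<Sum>j\<le>card A. esym A j x * u ^ j * v ^ (card A - j))"
    unfolding esym_def sum_distrib_right by (intro sum.cong refl) auto
  finally show ?thesis .
qed

lemma nsym_0: "finite A \<Longrightarrow> nsym A 0 x = 1"
  by (simp add: nsym_def esym_0)

lemma nsym_eq_0: "card A < k \<Longrightarrow> nsym A k x = 0"
  by (simp add: nsym_def)

lemma nsym_nonneg: "(\<And>i. i \<in> A \<Longrightarrow> 0 \<le> x i) \<Longrightarrow> 0 \<le> nsym A k x"
  by (simp add: nsym_def esym_nonneg)

lemma nsym_pos:
  "finite A \<Longrightarrow> k \<le> card A \<Longrightarrow> (\<And>i. i \<in> A \<Longrightarrow> 0 < x i) \<Longrightarrow> 0 < nsym A k x"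
  by (simp add: nsym_def esym_pos)

lemma esym_eq_nsym: "finite A \<Longrightarrow> esym A k x = real (card A choose k) * nsym A k x"
  by (cases "k \<le> card A") (auto simp: nsym_def esym_eq_0)

text \<open>This is \<open>esym_insert\<close> after normalisation. With \<open>N = card A\<close>,
  the weights come from (k+1) C(N+1,k+1) = (N+1) C(N,k) and (k+1) C(N,k+1) = (N-k) C(N,k).\<close>

lemma nsym_insert:
  assumes "finite A" "a \<notin> A" "k \<le> card A"
  shows "(real (card A) + 1) * nsym (insert a A) (Suc k) x
    = (real (card A) - real k) * nsym A (Suc k) x + (real k + 1) * x a * nsym A k x"
proof -
  define N where "N = card A"
  define b where "b = real (N choose k)"
  have b: "b > 0" using assms(3) by (simp add: b_def N_def)
  have "(real k + 1) * real (Suc N choose Suc k) = (real N + 1) * b"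
    unfolding b_def using Suc_times_binomial[of k N]
    by (metis add.commute mult.commute of_nat_Suc of_nat_mult)
  then have 1: "real (Suc N choose Suc k) = (real N + 1) * b / (real k + 1)"
    by (simp add: field_simps)
  have "(real k + 1) * (b + real (N choose Suc k)) = (real N + 1) * b"
    using 1 by (simp add: b_def field_simps)
  then have 2: "(real k + 1) * real (N choose Suc k) = (real N - real k) * b"
    by (simp add: algebra_simps)
  have "(real N + 1) * nsym (insert a A) (Suc k) x
      = (real N + 1) * (esym A (Suc k) x + x a * esym A k x) / real (Suc N choose Suc k)"
    using assms by (simp add: nsym_def esym_insert N_def)
  also have "\<dots> = (real k + 1) / b * (esym A (Suc k) x + x a * esym A k x)"
  proof -
    have "M * X / (M * b / K) = K / b * X" if "M \<noteq> 0" for M X K :: real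
      using that by simp
    then show ?thesis unfolding 1 by simp
  qed
  also have "\<dots> = (real k + 1) * real (N choose Suc k) / b * nsym A (Suc k) x
      + (real k + 1) * x a * nsym A k x"
    using assms(1) b by (simp add: esym_eq_nsym N_def[symmetric] b_def[symmetric] field_simps)
  also have "(real k + 1) * real (N choose Suc k) / b = real N - real k"
    unfolding 2 using b by simp
  finally show ?thesis by (simp add: N_def)
qed

section \<open>Newton's inequalities and log-concavity\<close>

text \<open>The induction step of Newton's inequality: \<open>p, q, r, t\<close> are consecutive normalised symmetric
  functions of the old variables, \<open>a\<close> is the new variable, and for \<open>K = 1\<close> the entry \<open>p\<close> is absent.\<close>
lemma newton_step:
  fixes p q r t a m K :: real
  assumes "0 \<le> p" "0 \<le> t" "0 < q" "0 < r" "0 \<le> a" "1 \<le> m" "1 \<le> K"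
    and pr: "p * r \<le> q\<^sup>2" and qt: "q * t \<le> r\<^sup>2"
  shows "((m + 1) * q + (K - 1) * a * p) * ((m - 1) * t + (K + 1) * a * r) \<le> (m * r + K * a * q)\<^sup>2"
proof -
  \<comment> \<open>Multiplying the two given inequalities and cancelling \<open>q * r > 0\<close>
    yields the cross inequality needed for the mixed term below.\<close>
  have "(q * r) * (p * t) = (p * r) * (q * t)" by simp
  also have "\<dots> \<le> q\<^sup>2 * r\<^sup>2" using assms by (intro mult_mono) auto
  also have "\<dots> = (q * r) * (q * r)" by (simp add: power2_eq_square)
  finally have pt: "p * t \<le> q * r"
    using assms(3,4) by (simp only: mult_le_cancel_left_pos mult_pos_pos)
  have m: "0 \<le> m\<^sup>2 - 1" "0 \<le> K\<^sup>2 - 1" using assms by auto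
  \<comment> \<open>The difference of the two sides decomposes into a square and nonnegative
    multiples of the three gaps \<open>r * r - q * t\<close>, \<open>q * q - p * r\<close> and
    \<open>q * r - p * t\<close>.\<close>
  have "(m * r + K * a * q)\<^sup>2
      - ((m + 1) * q + (K - 1) * a * p) * ((m - 1) * t + (K + 1) * a * r)
    = (r - a * q)\<^sup>2 + (m\<^sup>2 - 1) * (r\<^sup>2 - q * t) + a\<^sup>2 * (K\<^sup>2 - 1) * (q\<^sup>2 - p * r)
      + a * ((K - 1) * (m - 1)) * (q * r - p * t)"
    by (simp add: power2_eq_square algebra_simps)
  also have "\<dots> \<ge> 0"
    using assms m pt by (intro add_nonneg_nonneg mult_nonneg_nonneg) auto
  finally show ?thesis by simp
qed

text \<open>Induction on the set of variables: by \<open>nsym_insert\<close> the three new values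
  are affine in the new variable \<open>x a\<close>, with old values as coefficients, and
  \<open>newton_step\<close> combines two old inequalities. Positivity of the variables makes the
  middle values \<open>q\<close> and \<open>r\<close> positive.\<close>

lemma newton_inequality:
  assumes "finite A" "\<And>i. i \<in> A \<Longrightarrow> 0 < x i"
  shows "nsym A k x * nsym A (k + 2) x \<le> (nsym A (k + 1) x)\<^sup>2"
  using assms
proof (induction A arbitrary: k rule: finite_induct)
  case empty
  then show ?case by (simp add: nsym_eq_0)
next
  case (insert a A)
  define N where "N = card A"
  have pos: "x i > 0" if "i \<in> A" for i using insert.prems that by simp
  show ?case
  proof (cases "Suc k \<le> N")
    \<comment> \<open>Here \<open>k + 2\<close> exceeds the number of variables, so the left side is
      0.\<close>
    case False
    then show ?thesis
      using insert.hyps by (simp add: nsym_eq_0 N_def)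
  next
    case True
    \<comment> \<open>For \<open>k = 0\<close> there is no preceding function; the value 0 makes
      \<open>p * r\<close> vanish, and the recursion multiplies \<open>p\<close> by
      \<open>k = 0\<close> anyway.\<close>
    define p where "p = (if k = 0 then 0 else nsym A (k - 1) x)"
    define q where "q = nsym A k x"
    define r where "r = nsym A (k + 1) x"
    define t where "t = nsym A (k + 2) x"
    have IH: "nsym A j x * nsym A (j + 2) x \<le> (nsym A (j + 1) x)\<^sup>2" for j
      using insert.IH pos by blast
    have pr: "p * r \<le> q\<^sup>2"
      using IH[of "k - 1"] by (auto simp: p_def q_def r_def)
    have qt: "q * t \<le> r\<^sup>2"
      using IH[of k] by (simp add: q_def r_def t_def)
    have nn: "0 \<le> p" "0 \<le> t" "0 < q" "0 < r"
      using True insert.hyps(1) pos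
      by (auto simp: p_def q_def r_def t_def N_def less_imp_le intro!: nsym_nonneg nsym_pos)
    note rec = nsym_insert[OF insert.hyps(1,2), where x = x, folded N_def]
    have 0: "(real N + 1) * nsym (insert a A) k x = (real N - real k + 1) * q + real k * x a * p"
    proof (cases k)
      case 0
      then show ?thesis using insert.hyps by (simp add: nsym_0 q_def)
    next
      case (Suc j)
      then show ?thesis using True rec[of j] by (simp add: q_def p_def algebra_simps)
    qed
    have 1: "(real N + 1) * nsym (insert a A) (k + 1) x
        = (real N - real k) * r + (real k + 1) * x a * q"
      using True rec[of k] by (simp add: q_def r_def)
    have 2: "(real N + 1) * nsym (insert a A) (k + 2) x
        = (real N - real k - 1) * t + (real k + 2) * x a * r"
      using True rec[of "Suc k"] by (simp add: t_def r_def algebra_simps)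
    have "(real N + 1)\<^sup>2 * (nsym (insert a A) k x * nsym (insert a A) (k + 2) x)
        = ((real N - real k + 1) * q + real k * x a * p)
          * ((real N - real k - 1) * t + (real k + 2) * x a * r)"
      unfolding 0[symmetric] 2[symmetric] by (simp only: power2_eq_square ac_simps)
    \<comment> \<open>\<open>newton_step\<close> applies with \<open>m = N - k\<close>, which is at
      least 1 in this case, and \<open>K = k + 1\<close>.\<close>
    also have "\<dots> \<le> ((real N - real k) * r + (real k + 1) * x a * q)\<^sup>2"
      using newton_step[OF nn, of "x a" "real N - real k" "real k + 1"] pr qt True
        insert.prems[of a]
      by (simp add: algebra_simps)
    also have "\<dots> = (real N + 1)\<^sup>2 * (nsym (insert a A) (k + 1) x)\<^sup>2"
      unfolding 1[symmetric] by (simp only: power_mult_distrib)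
    finally show ?thesis
      by (subst (asm) mult_le_cancel_left_pos) auto
  qed
qed

text \<open>Log-concavity makes the ratios of consecutive terms decrease, so on either side of the
  pivot \<open>Suc k\<close> they compare with the ratio \<open>r\<close> just below it. The bound
  is multiplied by \<open>r ^ Suc k\<close> to avoid negative exponents.\<close>

lemma log_concave_ratio_bound:
  fixes s :: "nat \<Rightarrow> real"
  assumes pos: "\<And>j. j \<le> N \<Longrightarrow> 0 < s j"
    and lc: "\<And>j. j + 2 \<le> N \<Longrightarrow> s j * s (j + 2) \<le> (s (j + 1))\<^sup>2"
    and k: "Suc k \<le> N" and j: "j \<le> N"
  shows "s j * (s (Suc k) / s k) ^ Suc k \<le> s (Suc k) * (s (Suc k) / s k) ^ j"
proof -
  define r where "r = s (Suc k) / s k"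
  have r: "r > 0" using pos k by (simp add: r_def)
  have anti: "s (Suc j) / s j \<le> s (Suc i) / s i" if "i \<le> j" "Suc j \<le> N" for i j
    using that
  proof (induction rule: dec_induct)
    case (step n)
    have "s n > 0" "s (Suc n) > 0" using step pos by auto
    then have "s (Suc (Suc n)) / s (Suc n) \<le> s (Suc n) / s n"
      using lc[of n] step by (simp add: field_simps power2_eq_square)
    then show ?case using step by simp
  qed simp
  have "s j * r ^ Suc k \<le> s (Suc k) * r ^ j"
  proof (cases "Suc k \<le> j")
    case True
    then show ?thesis using j
    proof (induction rule: dec_induct)
      case (step n)
      \<comment> \<open>Going up from the pivot, every ratio is at most \<open>r\<close>.\<close>
      have "s (Suc n) \<le> r * s n"
        using anti[of k n] step pos[of n] by (simp add: r_def pos_divide_le_eq)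
      then have "s (Suc n) * r ^ Suc k \<le> r * s n * r ^ Suc k"
        using r by (intro mult_right_mono) auto
      also have "\<dots> = r * (s n * r ^ Suc k)" by simp
      also have "\<dots> \<le> r * (s (Suc k) * r ^ n)"
        using step r by (intro mult_left_mono) auto
      finally show ?case by (simp add: ac_simps)
    qed simp
  next
    case False
    then have "j \<le> Suc k" by simp
    then show ?thesis
    proof (induction rule: inc_induct)
      case (step n)
      \<comment> \<open>Going down from the pivot, every ratio is at least \<open>r\<close>.\<close>
      have "r * s n \<le> s (Suc n)"
        using anti[of n k] step k pos[of n] by (simp add: r_def pos_le_divide_eq)
      then have "r * s n * r ^ Suc k \<le> s (Suc n) * r ^ Suc k"
        using r by (intro mult_right_mono) auto
      also have "\<dots> \<le> s (Suc k) * r ^ Suc n" using step by simp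
      finally have "r * (s n * r ^ Suc k) \<le> r * (s (Suc k) * r ^ n)" by (simp add: ac_simps)
      then show ?case using r by simp
    qed simp
  qed
  then show ?thesis by (simp add: r_def)
qed

section \<open>Bounds for the objective function\<close>

text \<open>This is \<Phi> of the outline, with \<open>c\<close> and \<open>k\<close> as independent
  parameters; the relation \<open>c = k / n\<close> enters when the kernel is integrated.\<close>

definition HS_objective :: "real \<Rightarrow> nat \<Rightarrow> 'a set \<Rightarrow> ('a \<Rightarrow> real) \<Rightarrow> real \<Rightarrow> real" where
  "HS_objective c k A x y = y ^ k * (\<Prod>i\<in>A. c / y * x i + (1 - c))"

lemma HS_objective_nonneg:
  assumes "\<And>i. i \<in> A \<Longrightarrow> 0 \<le> x i" "0 < y" "0 \<le> c" "c \<le> 1"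
  shows "0 \<le> HS_objective c k A x y"
  unfolding HS_objective_def using assms by (intro mult_nonneg_nonneg prod_nonneg) auto

lemma HS_objective_mono:
  assumes "\<And>i. i \<in> A \<Longrightarrow> 0 \<le> x i" "\<And>i. i \<in> A \<Longrightarrow> x i \<le> x' i" "0 < y" "0 \<le> c" "c \<le> 1"
  shows "HS_objective c k A x y \<le> HS_objective c k A x' y"
  unfolding HS_objective_def using assms
  by (intro mult_left_mono prod_mono) (auto intro!: divide_right_mono mult_left_mono)

text \<open>All terms of the expansion are nonnegative, and in the term of degree \<open>k\<close>
  the powers of \<open>y\<close> cancel, so this bound is uniform in \<open>y\<close>.\<close>

lemma HS_objective_ge:
  assumes "finite A" "k \<le> card A" "\<And>i. i \<in> A \<Longrightarrow> 0 \<le> x i" "0 < y" "0 \<le> c" "c \<le> 1"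
  shows "esym A k x * c ^ k * (1 - c) ^ (card A - k) \<le> HS_objective c k A x y"
proof -
  have "esym A k x * (c / y) ^ k * (1 - c) ^ (card A - k) \<le> (\<Prod>i\<in>A. c / y * x i + (1 - c))"
    unfolding prod_affine_eq_sum_esym[OF assms(1)] using assms
    by (intro member_le_sum[where f = "\<lambda>j. esym A j x * (c / y) ^ j * (1 - c) ^ (card A - j)"])
       (auto intro!: mult_nonneg_nonneg esym_nonneg)
  then have "y ^ k * (esym A k x * (c / y) ^ k * (1 - c) ^ (card A - k)) \<le> HS_objective c k A x y"
    unfolding HS_objective_def using assms(4) by (intro mult_left_mono) auto
  then show ?thesis using assms(4) by (simp add: power_divide)
qed

text \<open>The witness is the ratio \<open>r\<close> of the normalised functions of orders
  \<open>k\<close> and \<open>k - 1\<close>. At \<open>y = r\<close> the value is a binomially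
  weighted average of the numbers \<open>nsym A j x * r ^ k / r ^ j\<close>, each at most
  \<open>nsym A k x\<close>.\<close>

lemma HS_objective_le_nsym:
  assumes "finite A" "1 \<le> k" "k \<le> card A" "\<And>i. i \<in> A \<Longrightarrow> 0 < x i" "0 \<le> c" "c \<le> 1"
  obtains y where "0 < y" "HS_objective c k A x y \<le> nsym A k x"
proof -
  obtain l where l: "k = Suc l" using assms(2) by (cases k) auto
  define r where "r = nsym A k x / nsym A l x"
  have r: "0 < r"
    using assms l by (simp add: r_def nsym_pos)
  have bd: "nsym A j x * r ^ k \<le> nsym A k x * r ^ j" if "j \<le> card A" for j
    unfolding r_def l using assms l that
    by (intro log_concave_ratio_bound[where N = "card A"] nsym_pos newton_inequality) auto
  have "HS_objective c k A x r
      = (\<Sum>j\<le>card A. r ^ k * (esym A j x * (c / r) ^ j * (1 - c) ^ (card A - j)))"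
    unfolding HS_objective_def prod_affine_eq_sum_esym[OF assms(1)] sum_distrib_left ..
  also have "\<dots> \<le> (\<Sum>j\<le>card A. nsym A k x * (real (card A choose j) * c ^ j * (1 - c) ^ (card A - j)))"
  proof (rule sum_mono)
    fix j assume "j \<in> {..card A}"
    then have "nsym A j x * r ^ k / r ^ j \<le> nsym A k x"
      using bd[of j] r by (simp add: pos_divide_le_eq)
    then have "nsym A j x * r ^ k / r ^ j * (real (card A choose j) * c ^ j * (1 - c) ^ (card A - j))
        \<le> nsym A k x * (real (card A choose j) * c ^ j * (1 - c) ^ (card A - j))"
      using assms by (intro mult_right_mono) auto
    then show "r ^ k * (esym A j x * (c / r) ^ j * (1 - c) ^ (card A - j))
        \<le> nsym A k x * (real (card A choose j) * c ^ j * (1 - c) ^ (card A - j))"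
      using assms(1) by (simp add: esym_eq_nsym power_divide ac_simps)
  qed
  also have "\<dots> = nsym A k x * (c + (1 - c)) ^ card A"
    unfolding binomial_ring sum_distrib_left[symmetric] ..
  finally show ?thesis using that r by simp
qed

section \<open>Integration against the empirical measure\<close>

text \<open>As an image of the uniform measure on the indices, the empirical measure turns integrals
  into finite sums, with repeated points counted by multiplicity.\<close>

lemma empirical_eq_distr:
  assumes nonneg: "\<And>i. i \<in> {1..n} \<Longrightarrow> 0 \<le> x i"
  shows "empirical n x = distr (uniform_count_measure {1..n}) nonneg_borel x"
proof (rule measure_eqI)
  show "sets (empirical n x) = sets (distr (uniform_count_measure {1..n}) nonneg_borel x)" by simp
  have meas: "x \<in> measurable (uniform_count_measure {1..n}) nonneg_borel"
    by (intro measurableI)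
       (use assms(1) in \<open>auto simp: space_uniform_count_measure sets_uniform_count_measure
         space_restrict_space\<close>)
  fix A assume "A \<in> sets (empirical n x)"
  then have A: "A \<in> sets nonneg_borel" by simp
  have "(\<Sum>i\<in>{1..n}. emeasure (return nonneg_borel (x i)) A)
      = (\<Sum>i\<in>{1..n}. if x i \<in> A then 1 else 0)"
    using A by (intro sum.cong) (auto simp: emeasure_return indicator_def)
  also have "\<dots> = of_nat (card (x -` A \<inter> {1..n}))"
    by (simp add: sum.If_cases vimage_def Int_commute)
  finally show "emeasure (empirical n x) A
      = emeasure (distr (uniform_count_measure {1..n}) nonneg_borel x) A"
    using A meas
    by (cases "n = 0") (simp_all add: emeasure_empirical emeasure_distr emeasure_uniform_count_measure
        space_uniform_count_measure ennreal_of_nat_eq_real_of_nat divide_ennreal)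
qed

lemma nn_integral_empirical:
  assumes "\<And>i. i \<in> {1..n} \<Longrightarrow> 0 \<le> x i" "f \<in> borel_measurable nonneg_borel"
  shows "(\<integral>\<^sup>+ t. f t \<partial>empirical n x) = (\<Sum>i\<in>{1..n}. ennreal (1 / real n) * f (x i))"
proof -
  have meas: "x \<in> measurable (uniform_count_measure {1..n}) nonneg_borel"
    by (intro measurableI)
       (use assms(1) in \<open>auto simp: space_uniform_count_measure sets_uniform_count_measure
         space_restrict_space\<close>)
  have eq: "empirical n x = distr (uniform_count_measure {1..n}) nonneg_borel x"
    using assms(1) by (rule empirical_eq_distr)
  show ?thesis
    unfolding eq using meas assms(2)
    by (subst nn_integral_distr)
       (simp_all add: uniform_count_measure_def nn_integral_point_measure_finite)
qed

lemma HS_kernel_measurable: "(\<lambda>t. HS_kernel t y c) \<in> borel_measurable nonneg_borel"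
proof -
  note [measurable] = ext_ln_measurable
  have "(\<lambda>t. HS_kernel t y c) \<in> borel_measurable borel"
    unfolding HS_kernel_def by measurable
  then show ?thesis by (rule measurable_restrict_space1)
qed

lemma ext_exp_infinity [simp]: "ext_exp \<infinity> = \<infinity>" "ext_exp (-\<infinity>) = 0"
  by (metis ext_exp.simps(2) infinity_ereal_def) (metis ext_exp.simps(3) MInfty_eq_minfinity)

lemma ext_exp_mono: "a \<le> b \<Longrightarrow> ext_exp a \<le> ext_exp b"
  by (cases a; cases b) (auto simp: ennreal_leI)

lemma ext_integral_empirical_real:
  assumes "\<And>i. i \<in> {1..n} \<Longrightarrow> 0 \<le> x i" "f \<in> borel_measurable nonneg_borel"
    and g: "\<And>i. i \<in> {1..n} \<Longrightarrow> f (x i) = ereal (g i)"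
  shows "ext_integral (empirical n x) f = ereal ((\<Sum>i\<in>{1..n}. g i) / real n)"
proof -
  \<comment> \<open>The coercion \<open>ennreal\<close> truncates negative numbers to 0, so only
    positive parts survive; used for both \<open>g\<close> and its negative.\<close>
  have *: "(\<Sum>i\<in>{1..n}. ennreal (1 / real n) * ennreal (h i))
      = ennreal (\<Sum>i\<in>{1..n}. max 0 (h i) / real n)" for h :: "nat \<Rightarrow> real"
  proof -
    have "(\<Sum>i\<in>{1..n}. ennreal (1 / real n) * ennreal (h i))
        = (\<Sum>i\<in>{1..n}. ennreal (max 0 (h i) / real n))"
    proof (intro sum.cong refl)
      show "ennreal (1 / real n) * ennreal (h i) = ennreal (max 0 (h i) / real n)" for i
        by (cases "0 \<le> h i") (simp_all add: ennreal_mult[symmetric] ennreal_neg max_def)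
    qed
    then show ?thesis by (simp add: sum_ennreal)
  qed
  have pos: "(\<integral>\<^sup>+ t. e2ennreal (f t) \<partial>empirical n x) = ennreal (\<Sum>i\<in>{1..n}. max 0 (g i) / real n)"
    unfolding *[symmetric] using assms by (subst nn_integral_empirical) (auto intro!: sum.cong)
  have neg: "(\<integral>\<^sup>+ t. e2ennreal (- f t) \<partial>empirical n x)
      = ennreal (\<Sum>i\<in>{1..n}. max 0 (- g i) / real n)"
    unfolding *[symmetric] using assms by (subst nn_integral_empirical) (auto intro!: sum.cong)
  have "(\<Sum>i\<in>{1..n}. max 0 (g i) / real n) - (\<Sum>i\<in>{1..n}. max 0 (- g i) / real n)
      = (\<Sum>i\<in>{1..n}. g i / real n)"
    unfolding sum_subtractf[symmetric] by (intro sum.cong) (auto simp: max_def)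
  then show ?thesis
    unfolding ext_integral_def pos neg by (simp add: sum_nonneg sum_divide_distrib)
qed

text \<open>The point \<open>x j\<close> has mass at least \<open>1 / n\<close>, so the negative
  part has infinite integral, while the positive part is a finite sum of finite terms.\<close>

lemma ext_integral_empirical_MInf:
  assumes "\<And>i. i \<in> {1..n} \<Longrightarrow> 0 \<le> x i" "f \<in> borel_measurable nonneg_borel"
    and "\<And>i. i \<in> {1..n} \<Longrightarrow> f (x i) \<noteq> \<infinity>" "j \<in> {1..n}" "f (x j) = -\<infinity>"
  shows "ext_integral (empirical n x) f = -\<infinity>"
proof -
  have "(\<integral>\<^sup>+ t. e2ennreal (f t) \<partial>empirical n x) \<noteq> top"
  proof -
    have "e2ennreal (f (x i)) \<noteq> top" if "i \<in> {1..n}" for i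
      using assms(3)[OF that] by (cases "f (x i)") (auto simp: e2ennreal_neg)
    then show ?thesis
      using assms(1,2) by (subst nn_integral_empirical) (auto simp: ennreal_mult_eq_top_iff)
  qed
  moreover have "(\<integral>\<^sup>+ t. e2ennreal (- f t) \<partial>empirical n x) = top"
    using assms by (subst nn_integral_empirical)
      (auto simp: ennreal_mult_eq_top_iff intro!: bexI[of _ j])
  ultimately show ?thesis
    unfolding ext_integral_def
    by (cases "\<integral>\<^sup>+ t. e2ennreal (f t) \<partial>empirical n x") auto
qed

section \<open>The HS mean as an infimum of roots of the objective\<close>

text \<open>The factor \<open>1 / c\<close> of the kernel and the weight \<open>1 / n\<close>
  multiply to \<open>1 / k\<close>, so the integral is the logarithm of the \<open>k\<close>-th root
  of the objective.\<close>

lemma ext_exp_integral_HS_kernel: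
  assumes "1 \<le> k" "k \<le> n" "\<And>i. i \<in> {1..n} \<Longrightarrow> 0 \<le> x i" "0 < y"
  shows "ext_exp (ext_integral (empirical n x) (\<lambda>t. HS_kernel t y (real k / real n)))
    = ennreal (HS_objective (real k / real n) k {1..n} x y powr (1 / real k))"
proof -
  define c where "c = real k / real n"
  have c: "0 < c" "c \<le> 1" using assms by (auto simp: c_def)
  define w where "w i = c / y * x i + (1 - c)" for i
  have obj: "HS_objective c k {1..n} x y = y ^ k * (\<Prod>i\<in>{1..n}. w i)"
    by (simp add: HS_objective_def w_def)
  have w0: "0 \<le> w i" if "i \<in> {1..n}" for i using c assms that by (simp add: w_def)
  have K: "HS_kernel (x i) y c = ereal (ln y) + ereal (1 / c) * ext_ln (w i)" for i
    using c by (simp add: HS_kernel_def w_def field_simps)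
  show ?thesis
  proof (cases "\<forall>i\<in>{1..n}. 0 < w i")
    case True
    then have P: "0 < (\<Prod>i\<in>{1..n}. w i)" by (intro prod_pos) auto
    have "ext_integral (empirical n x) (\<lambda>t. HS_kernel t y c)
        = ereal ((\<Sum>i\<in>{1..n}. ln y + 1 / c * ln (w i)) / real n)"
      using assms True by (intro ext_integral_empirical_real HS_kernel_measurable)
        (auto simp: K ext_ln_def)
    also have "(\<Sum>i\<in>{1..n}. ln y + 1 / c * ln (w i)) / real n
        = ln y + (\<Sum>i\<in>{1..n}. ln (w i)) / real k"
      using assms(1,2)
      by (simp add: sum.distrib sum_distrib_left[symmetric] c_def add_divide_distrib
          sum_divide_distrib[symmetric])
    also have "\<dots> = 1 / real k * ln (y ^ k * (\<Prod>i\<in>{1..n}. w i))"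
    proof -
      have "ln (\<Prod>i\<in>{1..n}. w i) = (\<Sum>i\<in>{1..n}. ln (w i))"
        using True by (intro ln_prod) (metis less_irrefl finite_atLeastAtMost)+
      then show ?thesis
        using less_imp_neq[OF P] assms(1,4)
        by (simp add: ln_mult ln_realpow field_simps del: prod_zero_iff)
    qed
    finally show ?thesis
      unfolding c_def[symmetric] obj using assms(4) less_imp_neq[OF P]
      by (simp add: powr_def del: prod_zero_iff)
  next
    \<comment> \<open>A zero factor occurs only for \<open>c = 1\<close> and \<open>x j = 0\<close>;
      the integral is then infinite negative and both sides are 0.\<close>
    case False
    then obtain j where j: "j \<in> {1..n}" "w j = 0" using w0 by force
    have "ext_integral (empirical n x) (\<lambda>t. HS_kernel t y c) = -\<infinity>"
      using assms c j by (intro ext_integral_empirical_MInf[where j = j] HS_kernel_measurable)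
        (auto simp: K ext_ln_def)
    moreover have "(\<Prod>i\<in>{1..n}. w i) = 0" using j by auto
    ultimately show ?thesis
      unfolding c_def[symmetric] obj by simp
  qed
qed

lemma hsm_le:
  assumes "1 \<le> k" "k \<le> n" "\<And>i. i \<in> {1..n} \<Longrightarrow> 0 \<le> x i" "0 < y"
  shows "hsm (real k / real n) n x
    \<le> ennreal (HS_objective (real k / real n) k {1..n} x y powr (1 / real k))"
proof -
  have "hsm (real k / real n) n x
      \<le> ext_exp (ext_integral (empirical n x) (\<lambda>t. HS_kernel t y (real k / real n)))"
    unfolding hsm_def HS_barycenter_def using assms(4) by (intro ext_exp_mono INF_lower) auto
  also have "\<dots> = ennreal (HS_objective (real k / real n) k {1..n} x y powr (1 / real k))"
    using assms by (rule ext_exp_integral_HS_kernel)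
  finally show ?thesis .
qed

lemma hsm_ge:
  assumes "1 \<le> k" "k \<le> n" "\<And>i. i \<in> {1..n} \<Longrightarrow> 0 \<le> x i"
    and L: "\<And>y. 0 < y \<Longrightarrow> L \<le> HS_objective (real k / real n) k {1..n} x y powr (1 / real k)"
  shows "ennreal L \<le> hsm (real k / real n) n x"
proof (cases "0 < L")
  case True
  \<comment> \<open>Passing to logarithms puts the bound inside the infimum, so that monotonicity of
    \<open>ext_exp\<close> suffices.\<close>
  have "ereal (ln L) \<le> ext_integral (empirical n x) (\<lambda>t. HS_kernel t y (real k / real n))"
    if "0 < y" for y
  proof -
    have "ennreal L \<le> ext_exp (ext_integral (empirical n x) (\<lambda>t. HS_kernel t y (real k / real n)))"
      using ext_exp_integral_HS_kernel[of k n x y] assms(1-3) that L[OF that] ennreal_leI by auto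
    with True show ?thesis
      by (cases "ext_integral (empirical n x) (\<lambda>t. HS_kernel t y (real k / real n))")
         (auto simp: ln_le_cancel_iff[symmetric] simp del: ln_le_cancel_iff)
  qed
  then have "ext_exp (ereal (ln L)) \<le> hsm (real k / real n) n x"
    unfolding hsm_def HS_barycenter_def by (intro ext_exp_mono INF_greatest) auto
  then show ?thesis using True by simp
qed (simp add: ennreal_neg)

section \<open>The two inequalities\<close>

lemma sym_mean_eq_nsym: "sym_mean k n x = nsym {1..n} k x powr (1 / real k)"
  by (simp add: sym_mean_def elem_sym_def nsym_def esym_def)

text \<open>For \<open>c = k / n\<close> the exponent \<open>(1 - c) / c\<close> equals
  \<open>(n - k) / k\<close>. At \<open>k = n\<close> the factor \<open>0 ^ 0 = 1\<close> agrees
  with the value 1 prescribed for \<open>c = 1\<close>.\<close>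

lemma HS_B_eq:
  assumes "1 \<le> k" "k \<le> n"
  shows "HS_B (real k / real n)
    = ((real k / real n) ^ k * (1 - real k / real n) ^ (n - k)) powr (1 / real k)"
proof (cases "k = n")
  case True
  then show ?thesis using assms by (simp add: HS_B_def)
next
  case False
  define c where "c = real k / real n"
  have c: "0 < c" "c < 1" using assms False by (auto simp: c_def)
  have e: "(1 - c) / c = real (n - k) / real k"
    using assms by (simp add: c_def of_nat_diff field_simps)
  have "(c ^ k * (1 - c) ^ (n - k)) powr (1 / real k)
      = (c powr real k) powr (1 / real k) * ((1 - c) powr real (n - k)) powr (1 / real k)"
    using c by (simp add: powr_mult powr_realpow)
  also have "\<dots> = c * (1 - c) powr ((1 - c) / c)"
    using assms c by (simp add: powr_powr e)
  finally show ?thesis using c assms False by (simp add: HS_B_def c_def)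
qed

theorem theorem3p4:
  fixes n k :: nat and x :: "nat \<Rightarrow> real"
  assumes "1 \<le> k" and "k \<le> n"
    and "\<And>i. i \<in> {1..n} \<Longrightarrow> 0 \<le> x i"
  shows "hsm (real k / real n) n x \<le> ennreal (sym_mean k n x) \<and>
    ennreal (sym_mean k n x)
      \<le> ennreal (real (n choose k) powr (- 1 / real k) / HS_B (real k / real n))
        * hsm (real k / real n) n x"
proof
  define c where "c = real k / real n"
  have c: "0 < c" "c \<le> 1" using assms by (auto simp: c_def)
  show "hsm (real k / real n) n x \<le> ennreal (sym_mean k n x)"
  proof (rule tendsto_lowerbound)
    show "((\<lambda>e. ennreal (sym_mean k n (\<lambda>i. x i + e))) \<longlongrightarrow> ennreal (sym_mean k n x)) (at_right 0)"
    proof -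
      have "((\<lambda>e. nsym {1..n} k (\<lambda>i. x i + e)) \<longlongrightarrow> nsym {1..n} k (\<lambda>i. x i + 0)) (at_right 0)"
        unfolding nsym_def esym_def
        by (intro tendsto_intros) (use assms in auto)
      then show ?thesis
        \<comment> \<open>The base may tend to 0, where continuity of \<open>powr\<close> relies on
          nonnegative bases and the positive exponent \<open>1 / k\<close>.\<close>
        unfolding sym_mean_eq_nsym using assms
        by (intro tendsto_ennrealI tendsto_powr2)
           (auto intro!: nsym_nonneg add_nonneg_nonneg eventually_at_rightI[of 0 1])
    qed
    show "\<forall>\<^sub>F e in at_right 0. hsm (real k / real n) n x \<le> ennreal (sym_mean k n (\<lambda>i. x i + e))"
      unfolding eventually_at_right_field
    proof (intro exI[of _ 1] conjI allI impI)
      fix e :: real assume e: "0 < e" "e < 1"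
      have "0 < x i + e" if "i \<in> {1..n}" for i using assms(3)[OF that] e by simp
      then obtain y where y: "0 < y"
        "HS_objective c k {1..n} (\<lambda>i. x i + e) y \<le> nsym {1..n} k (\<lambda>i. x i + e)"
        using assms(1,2) c
        by (rule_tac HS_objective_le_nsym[where A = "{1..n}" and k = k and c = c
              and x = "\<lambda>i. x i + e"]) auto
      \<comment> \<open>The \<open>y\<close> found for the shifted tuple serves for \<open>x\<close>
        too, since the objective increases in each variable.\<close>
      have "HS_objective c k {1..n} x y \<le> HS_objective c k {1..n} (\<lambda>i. x i + e) y"
        using assms c y e by (intro HS_objective_mono) auto
      then have "HS_objective c k {1..n} x y powr (1 / real k) \<le> sym_mean k n (\<lambda>i. x i + e)"
        unfolding sym_mean_eq_nsym using y assms c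
        by (intro powr_mono2 HS_objective_nonneg) auto
      then show "hsm (real k / real n) n x \<le> ennreal (sym_mean k n (\<lambda>i. x i + e))"
        using hsm_le[OF assms y(1)] unfolding c_def by (meson ennreal_leI order_trans)
    qed simp
  qed simp
  \<comment> \<open>\<open>L\<close> is the \<open>k\<close>-th root of the degree \<open>k\<close>
    term, a lower bound valid for every \<open>y\<close>; it factors as the \<open>k\<close>-th root
    of \<open>esym {1..n} k x\<close> times \<open>HS_B c\<close>.\<close>
  define L where "L = (esym {1..n} k x * (c ^ k * (1 - c) ^ (n - k))) powr (1 / real k)"
  have E: "0 \<le> esym {1..n} k x" using assms(3) by (rule esym_nonneg)
  have B: "HS_B c > 0"
    using c by (auto simp: HS_B_def)
  have "ennreal L \<le> hsm (real k / real n) n x"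
  proof (rule hsm_ge[OF assms])
    fix y :: real assume "0 < y"
    then have "esym {1..n} k x * (c ^ k * (1 - c) ^ (n - k)) \<le> HS_objective c k {1..n} x y"
      using HS_objective_ge[of "{1..n}" k x y c] assms c by (simp add: mult.assoc)
    then show "L \<le> HS_objective (real k / real n) k {1..n} x y powr (1 / real k)"
      unfolding L_def c_def[symmetric] using E c
      by (intro powr_mono2 mult_nonneg_nonneg) auto
  qed
  have "L = esym {1..n} k x powr (1 / real k) * HS_B c"
    unfolding L_def c_def HS_B_eq[OF assms(1,2)] by (rule powr_mult)
  then have "sym_mean k n x = real (n choose k) powr (- 1 / real k) / HS_B c * L"
    unfolding sym_mean_eq_nsym nsym_def using E B
    by (simp add: powr_divide powr_minus_divide)
  moreover have "0 \<le> real (n choose k) powr (- 1 / real k) / HS_B c" "0 \<le> L"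
    using B by (simp_all add: L_def)
  ultimately have "ennreal (sym_mean k n x)
      = ennreal (real (n choose k) powr (- 1 / real k) / HS_B c) * ennreal L"
    by (simp only: ennreal_mult)
  also have "\<dots>
      \<le> ennreal (real (n choose k) powr (- 1 / real k) / HS_B c) * hsm (real k / real n) n x"
    using \<open>ennreal L \<le> _\<close> by (rule mult_left_mono) simp
  finally show "ennreal (sym_mean k n x)
      \<le> ennreal (real (n choose k) powr (- 1 / real k) / HS_B (real k / real n))
        * hsm (real k / real n) n x"
    by (simp add: c_def)
qed

end
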